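(* Let $k\geq 1$ be an integer and let $0<\delta\leq 1$ be a real number such that $n=(1+\delta)2^k$ is an integer. Then in every $k$-edge-colouring of the complete graph $K_n$ there is a monochromatic odd cycle of length at most $4k^{3/2}\delta^{-1/2}$.
   Context: A $k$-edge-colouring of a graph is an arbitrary assignment of one of $k$ colours to each edge (it need not be proper). A cycle is monochromatic if all its edges have the same colour. An odd cycle is a cycle with an odd number (at least $3$) of edges; its length is its number of edges. *)

theory Defs
  imports Complex_Main "HOL-Library.FuncSet" "Graph_Theory.Graph_Theory"
begin

text \<open>
  Undirected simple graphs are the symmetric digraphs of the locale \<open>graph\<close>, in which an
  undirected edge \<open>uv\<close> appears as the two arcs \<open>(u,v)\<close> and \<open>(v,u)\<close>. Colourings are functions on
  the two-element vertex sets \<open>{u,v}\<close>, so that both arcs of an edge receive the same colour.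
\<close>

definition arc_edge :: "('a, 'b) pre_digraph \<Rightarrow> 'b \<Rightarrow> 'a set" where
  "arc_edge G e = {tail G e, head G e}"

definition edge_set :: "('a, 'b) pre_digraph \<Rightarrow> 'a set set" where
  "edge_set G = arc_edge G ` arcs G"

definition edge_colouring :: "('a, 'b) pre_digraph \<Rightarrow> nat \<Rightarrow> ('a set \<Rightarrow> nat) \<Rightarrow> bool" where
  "edge_colouring G k c \<longleftrightarrow> c \<in> edge_set G \<rightarrow> {..<k}"

text \<open>
  Directed cycles of length at least 3 are the cycles of the undirected graph; an edge traversed
  back and forth is a directed cycle of length 2.
\<close>

definition odd_cycle :: "('a, 'b) pre_digraph \<Rightarrow> 'b awalk \<Rightarrow> bool" where
  "odd_cycle G p \<longleftrightarrow> pre_digraph.cycle G p \<and> 3 \<le> length p \<and> odd (length p)"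

definition monochromatic :: "('a, 'b) pre_digraph \<Rightarrow> ('a set \<Rightarrow> nat) \<Rightarrow> 'b awalk \<Rightarrow> bool" where
  "monochromatic G c p \<longleftrightarrow> (\<exists>i. \<forall>e \<in> set p. c (arc_edge G e) = i)"

lemma edge_set_complete:
  assumes "K\<^bsub>n\<^esub> G"
  shows "edge_set G = {e. e \<subseteq> verts G \<and> card e = 2}"
proof -
  have "edge_set G = (\<lambda>(u, v). {u, v}) ` arcs_ends G"
    by (auto simp: edge_set_def arc_edge_def arcs_ends_def arc_to_ends_def)
  also have "arcs_ends G = {(u, v). (u, v) \<in> verts G \<times> verts G \<and> u \<noteq> v}"
    using assms by (simp add: complete_digraph_def)
  finally show ?thesis
    by (auto simp: card_2_iff image_iff)
qed

end

theory Submission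
  imports Defs "HOL-Analysis.Convex" "HOL-Analysis.Function_Topology"
begin

text \<open>
  The argument bounds the Lovasz theta number of each colour class. Let \<open>J\<close> be the all-ones matrix on
  the \<open>n\<close>-element vertex set. Suppose that each colour class \<open>E i\<close> has a matrix \<open>Z i\<close> which vanishes on
  \<open>E i\<close>, has constant diagonal \<open>\<tau>\<close>, and exceeds \<open>J\<close> by a positive semidefinite matrix. Such
  matrices are preserved by entrywise products, except that the diagonals multiply. Every edge of the
  complete graph lies in some \<open>E i\<close>, so the product over all \<open>k\<close> colours is \<open>\<tau> ^ k\<close> times the
  identity, and it still exceeds \<open>J\<close>. Comparing the two on the all-ones vector gives \<open>n \<le> \<tau> ^ k\<close>
  (\<open>card_le_power_of_cover\<close>). A bipartite graph admits \<open>\<tau> = 2\<close>. A graph without short odd cycles admits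
  a \<open>\<tau>\<close> only slightly larger: if there is no closed odd walk of length at most \<open>d\<close>, with \<open>d\<close> odd, and
  \<open>cosh (d * t) \<ge> n - 1\<close>, then \<open>\<tau> = 1 + cosh t\<close> is possible (\<open>large_odd_girth_certificate\<close>).
  
  For this last claim, conic duality (\<open>conic_alternative\<close>) produces either \<open>Z i\<close> or a positive
  semidefinite matrix \<open>C\<close>, zero off the diagonal and \<open>E i\<close>, whose entries sum to more than \<open>1 + cosh t\<close>
  times its trace. In the second case, scaling the nonzero diagonal entries of \<open>C\<close> to 1 leads to a
  symmetric matrix \<open>A\<close> supported on \<open>E i\<close> with \<open>1 + A\<close> positive semidefinite and with largest eigenvalue
  above \<open>cosh t\<close>. Now consider \<open>M = 1 + T d A\<close>, where \<open>T d\<close> is the Chebyshev polynomial. As \<open>T d\<close> is an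
  odd polynomial and there are no short odd closed walks, \<open>T d A\<close> has zero diagonal, so \<open>M\<close> has trace
  \<open>n\<close>. For odd \<open>d\<close> the polynomial \<open>1 + T d x\<close> is \<open>1 + x\<close> times a square, so \<open>M\<close> is positive
  semidefinite, and hence has no eigenvalue above \<open>n\<close>. But \<open>T d (cosh s) = cosh (d * s)\<close>, so the top
  eigenvector of \<open>A\<close> gives \<open>M\<close> an eigenvalue above \<open>1 + cosh (d * t) \<ge> n\<close> (\<open>quad_le_cosh\<close>).
  
  With \<open>t = sqrt (\<delta> / k)\<close> and \<open>d\<close> the largest odd number up to the claimed bound, \<open>d * t\<close> is
  about \<open>4 * k\<close>, which makes \<open>cosh (d * t)\<close> at least \<open>2 ^ (k + 1) - 1 \<ge> n - 1\<close>. On the other hand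
  \<open>1 + cosh t < 2 * (1 + \<delta> / (2 * k))\<close>, whose \<open>k\<close>-th power is less than \<open>2 ^ k * (1 + \<delta>) = n\<close>. So the
  colour classes cannot all be free of short odd cycles.
\<close>

section \<open>Positive semidefinite matrices on a finite index set\<close>

text \<open>
  Matrices and vectors are plain functions that are only ever summed over a finite set \<open>V\<close>; their values
  outside \<open>V\<close> are arbitrary. This lets the dimension be the cardinality of the vertex set of a graph.
\<close>

definition sum_sq :: "'a set \<Rightarrow> ('a \<Rightarrow> real) \<Rightarrow> real" where
  "sum_sq V x = (\<Sum>v\<in>V. (x v)\<^sup>2)"

definition pairing :: "'a set \<Rightarrow> ('a \<Rightarrow> 'a \<Rightarrow> real) \<Rightarrow> ('a \<Rightarrow> 'a \<Rightarrow> real) \<Rightarrow> real" where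
  "pairing V A B = (\<Sum>u\<in>V. \<Sum>v\<in>V. A u v * B u v)"

abbreviation quad :: "'a set \<Rightarrow> ('a \<Rightarrow> 'a \<Rightarrow> real) \<Rightarrow> ('a \<Rightarrow> real) \<Rightarrow> real" where
  "quad V A x \<equiv> pairing V A (\<lambda>u v. x u * x v)"

definition sym_mat :: "'a set \<Rightarrow> ('a \<Rightarrow> 'a \<Rightarrow> real) \<Rightarrow> bool" where
  "sym_mat V A \<longleftrightarrow> (\<forall>u\<in>V. \<forall>v\<in>V. A u v = A v u)"

definition psd :: "'a set \<Rightarrow> ('a \<Rightarrow> 'a \<Rightarrow> real) \<Rightarrow> bool" where
  "psd V A \<longleftrightarrow> sym_mat V A \<and> (\<forall>x. 0 \<le> quad V A x)"

text \<open>
  The positive semidefinite cone is self-dual, so this is again positive semidefiniteness. Phrased as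
  membership in the dual cone, closure under entrywise products follows by moving one factor across the
  pairing, without diagonalising or factorising a matrix.
\<close>

definition dual_psd :: "'a set \<Rightarrow> ('a \<Rightarrow> 'a \<Rightarrow> real) \<Rightarrow> bool" where
  "dual_psd V P \<longleftrightarrow> sym_mat V P \<and> (\<forall>R. psd V R \<longrightarrow> 0 \<le> pairing V P R)"

lemma pairing_commute: "pairing V A B = pairing V B A"
  by (simp add: pairing_def mult.commute)

lemma pairing_add_left: "pairing V (\<lambda>u v. A u v + B u v) R = pairing V A R + pairing V B R"
  by (simp add: pairing_def distrib_right sum.distrib)

lemma pairing_scale_left: "pairing V (\<lambda>u v. c * A u v) R = c * pairing V A R"
  by (simp add: pairing_def sum_distrib_left mult.assoc)

lemma psdD: "psd V A \<Longrightarrow> 0 \<le> quad V A x"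
  by (simp add: psd_def)

lemma psd_rank_one: "psd V (\<lambda>u v. x u * x v)"
proof -
  have "quad V (\<lambda>u v. x u * x v) y = (\<Sum>u\<in>V. x u * y u)\<^sup>2" for y
    by (simp add: pairing_def power2_eq_square sum_product algebra_simps)
  then show ?thesis
    by (simp add: psd_def sym_mat_def)
qed

lemma dual_psd_imp_psd: "dual_psd V P \<Longrightarrow> psd V P"
  by (simp add: dual_psd_def psd_def[of V P] psd_rank_one)

lemma dual_psd_rank_one: "dual_psd V (\<lambda>u v. x u * x v)"
  by (auto simp: dual_psd_def sym_mat_def psd_def pairing_commute[of V "\<lambda>u v. x u * x v"])

lemma dual_psd_add: "dual_psd V P \<Longrightarrow> dual_psd V Q \<Longrightarrow> dual_psd V (\<lambda>u v. P u v + Q u v)"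
  by (simp add: dual_psd_def sym_mat_def pairing_add_left)

lemma dual_psd_scale: "0 \<le> c \<Longrightarrow> dual_psd V P \<Longrightarrow> dual_psd V (\<lambda>u v. c * P u v)"
  by (simp add: dual_psd_def sym_mat_def pairing_scale_left)

lemma psd_mult_rank_one:
  assumes "psd V R"
  shows "psd V (\<lambda>u v. R u v * (x u * x v))"
proof -
  have "quad V (\<lambda>u v. R u v * (x u * x v)) y = quad V R (\<lambda>u. x u * y u)" for y
    by (simp add: pairing_def algebra_simps)
  then show ?thesis
    using assms by (simp add: psd_def sym_mat_def mult.commute)
qed

text \<open>
  The pairing of \<open>P \<circ> Q\<close> with \<open>R\<close> is that of \<open>P\<close> with \<open>Q \<circ> R\<close>, where \<open>\<circ>\<close> is the entrywise product. In
  turn \<open>Q \<circ> R\<close> has a nonnegative quadratic form at \<open>x\<close> since this is the pairing of \<open>Q\<close> with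
  \<open>R \<circ> x x\<^sup>T\<close>, and \<open>R \<circ> x x\<^sup>T\<close> is obviously positive semidefinite.
\<close>

lemma dual_psd_hadamard:
  assumes "dual_psd V P" "dual_psd V Q"
  shows "dual_psd V (\<lambda>u v. P u v * Q u v)"
  unfolding dual_psd_def
proof (intro conjI allI impI)
  show "sym_mat V (\<lambda>u v. P u v * Q u v)"
    using assms by (simp add: dual_psd_def sym_mat_def)
  fix R assume R: "psd V R"
  have "psd V (\<lambda>u v. Q u v * R u v)"
    unfolding psd_def
  proof (intro conjI allI)
    show "sym_mat V (\<lambda>u v. Q u v * R u v)"
      using assms R by (simp add: dual_psd_def psd_def sym_mat_def)
    fix x
    have "0 \<le> pairing V Q (\<lambda>u v. R u v * (x u * x v))"
      using assms(2) psd_mult_rank_one[OF R] by (simp add: dual_psd_def)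
    then show "0 \<le> quad V (\<lambda>u v. Q u v * R u v) x"
      by (simp add: pairing_def mult.assoc)
  qed
  then have "0 \<le> pairing V P (\<lambda>u v. Q u v * R u v)"
    using assms(1) by (simp add: dual_psd_def)
  then show "0 \<le> pairing V (\<lambda>u v. P u v * Q u v) R"
    by (simp add: pairing_def mult.assoc)
qed

lemma quad_two_points:
  assumes "finite V" "sym_mat V A" "u \<in> V" "v \<in> V" "u \<noteq> v"
  shows "quad V A (\<lambda>w. if w = u then s else if w = v then t else 0)
           = s\<^sup>2 * A u u + 2 * s * t * A u v + t\<^sup>2 * A v v"
proof -
  let ?x = "\<lambda>w. if w = u then s else if w = v then t else 0"
  have inner: "(\<Sum>b\<in>V. A a b * (?x a * ?x b)) = ?x a * (s * A a u + t * A a v)" for a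
  proof -
    have "(\<Sum>b\<in>V. A a b * (?x a * ?x b))
        = (\<Sum>b\<in>V. (if b = u then ?x a * s * A a u else 0) + (if b = v then ?x a * t * A a v else 0))"
      using \<open>u \<noteq> v\<close> by (intro sum.cong) auto
    also have "\<dots> = ?x a * (s * A a u + t * A a v)"
      using assms by (simp add: sum.distrib algebra_simps)
    finally show ?thesis .
  qed
  have "quad V A ?x = (\<Sum>a\<in>V. (if a = u then s * (s * A u u + t * A u v) else 0)
                       + (if a = v then t * (s * A v u + t * A v v) else 0))"
    unfolding pairing_def inner using \<open>u \<noteq> v\<close> by (intro sum.cong) auto
  also have "\<dots> = s * (s * A u u + t * A u v) + t * (s * A v u + t * A v v)"
    using assms by (simp add: sum.distrib)
  also have "A v u = A u v"
    using assms by (simp add: sym_mat_def)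
  finally show ?thesis
    by (simp add: power2_eq_square algebra_simps)
qed

lemma quad_one_point:
  assumes "finite V" "u \<in> V"
  shows "quad V A (\<lambda>w. if w = u then s else 0) = s\<^sup>2 * A u u"
proof -
  have "quad V A (\<lambda>w. if w = u then s else 0)
     = (\<Sum>a\<in>V. \<Sum>b\<in>V. if b = u then (if a = u then s\<^sup>2 * A u u else 0) else 0)"
    unfolding pairing_def by (intro sum.cong) (auto simp: power2_eq_square)
  also have "\<dots> = s\<^sup>2 * A u u"
    using assms by simp
  finally show ?thesis .
qed

lemma psd_diag_nonneg:
  assumes "finite V" "psd V A" "u \<in> V"
  shows "0 \<le> A u u"
proof -
  have "0 \<le> quad V A (\<lambda>w. if w = u then 1 else 0)"
    by (rule psdD[OF assms(2)])
  also have "\<dots> = 1\<^sup>2 * A u u"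
    by (rule quad_one_point[OF assms(1,3)])
  finally show ?thesis
    by simp
qed

lemma psd_two_points:
  assumes "finite V" "psd V A" "u \<in> V" "v \<in> V" "u \<noteq> v"
  shows "0 \<le> s\<^sup>2 * A u u + 2 * s * t * A u v + t\<^sup>2 * A v v"
proof -
  have "0 \<le> quad V A (\<lambda>w. if w = u then s else if w = v then t else 0)"
    by (rule psdD[OF assms(2)])
  also have "\<dots> = s\<^sup>2 * A u u + 2 * s * t * A u v + t\<^sup>2 * A v v"
    using assms by (intro quad_two_points) (auto simp: psd_def)
  finally show ?thesis .
qed

lemma psd_entry_bound:
  assumes "finite V" "psd V A" "u \<in> V" "v \<in> V"
  shows "2 * \<bar>A u v\<bar> \<le> A u u + A v v"
proof (cases "u = v")
  case True
  then show ?thesis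
    using psd_diag_nonneg[OF assms(1-3)] by simp
next
  case False
  show ?thesis
    using psd_two_points[OF assms False, of 1 1] psd_two_points[OF assms False, of 1 "- 1"] by simp
qed

lemma psd_zero_row:
  assumes "finite V" "psd V A" "u \<in> V" "v \<in> V" "A u u = 0"
  shows "A u v = 0"
proof (rule ccontr)
  assume nz: "A u v \<noteq> 0"
  then have "u \<noteq> v"
    using assms by auto
  \<comment> \<open>the quadratic form at \<open>s\<close> times the unit vector of \<open>u\<close> plus that of \<open>v\<close> is linear in \<open>s\<close>; here it equals \<open>-1\<close>\<close>
  define s where "s = - (A v v + 1) / (2 * A u v)"
  have "0 \<le> s\<^sup>2 * A u u + 2 * s * 1 * A u v + 1\<^sup>2 * A v v"
    by (rule psd_two_points[OF assms(1-4) \<open>u \<noteq> v\<close>])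
  also have "\<dots> = - 1"
    using nz assms(5) by (simp add: s_def field_simps)
  finally show False
    by simp
qed

text \<open>
  The trace bounds the largest eigenvalue. With unit diagonal, all entries lie between \<open>-1\<close> and \<open>1\<close>, and
  the Cauchy-Schwarz inequality suffices.
\<close>

lemma psd_unit_diag_quad_le:
  assumes "finite V" "psd V M" "\<And>u. u \<in> V \<Longrightarrow> M u u = 1"
  shows "quad V M x \<le> card V * sum_sq V x"
proof -
  have "quad V M x \<le> (\<Sum>u\<in>V. \<Sum>v\<in>V. \<bar>x u\<bar> * \<bar>x v\<bar>)"
    unfolding pairing_def
  proof (intro sum_mono)
    fix u v assume "u \<in> V" "v \<in> V"
    then have "\<bar>M u v\<bar> \<le> 1"
      using psd_entry_bound[OF assms(1,2)] assms(3) by fastforce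
    then have "\<bar>M u v\<bar> * (\<bar>x u\<bar> * \<bar>x v\<bar>) \<le> 1 * (\<bar>x u\<bar> * \<bar>x v\<bar>)"
      by (intro mult_right_mono) auto
    then show "M u v * (x u * x v) \<le> \<bar>x u\<bar> * \<bar>x v\<bar>"
      using abs_ge_self[of "M u v * (x u * x v)"] unfolding abs_mult by linarith
  qed
  also have "\<dots> = (\<Sum>u\<in>V. \<bar>x u\<bar>)\<^sup>2"
    by (simp add: power2_eq_square sum_product)
  also have "\<dots> \<le> card V * (\<Sum>u\<in>V. \<bar>x u\<bar>\<^sup>2)"
    using sum_squared_le_sum_of_squares[of "\<lambda>u. \<bar>x u\<bar>" V] by (simp add: mult.commute)
  finally show ?thesis
    by (simp add: sum_sq_def)
qed

section \<open>Minimisers\<close>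

text \<open>
  Vectors and matrices live in the infinite product space of all functions; fixing their values outside
  a set of coordinates and bounding them inside gives a compact set by Tychonoff's theorem.
\<close>

lemma compact_box_functions:
  "compact {f :: 'i \<Rightarrow> real. \<forall>i. f i \<in> (if i \<in> I then {-R..R} else {0})}"
proof -
  let ?S = "\<lambda>i. if i \<in> I then {-R..R} else {0::real}"
  have "compactin (product_topology (\<lambda>i::'i. euclidean) UNIV) (PiE UNIV ?S)"
    by (subst compactin_PiE) auto
  also have "product_topology (\<lambda>i::'i. euclidean :: real topology) UNIV = euclidean"
    by (rule euclidean_product_topology)
  finally have "compact (PiE UNIV ?S)"
    by simp
  also have "PiE UNIV ?S = {f. \<forall>i. f i \<in> ?S i}"
    by (auto simp: PiE_def Pi_def)
  finally show ?thesis .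
qed

text \<open>
  First-order condition at a minimum, in a form that serves both one-sided perturbations (moving along
  a cone) and, applied to \<open>a\<close> and \<open>- a\<close>, two-sided ones.
\<close>

lemma nonneg_slope_if_min:
  fixes a b :: real
  assumes "\<And>e. 0 < e \<Longrightarrow> e \<le> 1 \<Longrightarrow> 0 \<le> 2 * e * a + e\<^sup>2 * b"
  shows "0 \<le> a"
proof (rule ccontr)
  assume a: "\<not> 0 \<le> a"
  \<comment> \<open>small enough that the linear term dominates the quadratic one\<close>
  define e where "e = min 1 (- a / (\<bar>b\<bar> + 1))"
  have e: "0 < e" "e \<le> 1"
    using a by (auto simp: e_def intro!: divide_neg_pos)
  have "e * b \<le> e * (\<bar>b\<bar> + 1)"
    using e by (intro mult_left_mono) auto
  also have "\<dots> \<le> (- a / (\<bar>b\<bar> + 1)) * (\<bar>b\<bar> + 1)"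
    by (intro mult_right_mono) (auto simp: e_def)
  also have "\<dots> = - a"
    by (simp add: add_nonneg_eq_0_iff)
  finally have "e * b \<le> - a" .
  then have "e * (2 * a + e * b) < 0"
    using e a by (intro mult_pos_neg) auto
  then show False
    using assms[OF e] by (simp add: power2_eq_square algebra_simps)
qed

text \<open>
  A maximiser of the quadratic form on the unit sphere is an eigenvector: \<open>l * sum_sq V y - quad V A y\<close>
  is nonnegative and vanishes there, so its first variation in each coordinate direction is zero.
\<close>

lemma top_eigenvector:
  assumes "finite V" "V \<noteq> {}" "sym_mat V A"
  shows "\<exists>x l. sum_sq V x = 1 \<and> (\<forall>u\<in>V. (\<Sum>v\<in>V. A u v * x v) = l * x u)
    \<and> (\<forall>y. quad V A y \<le> l * sum_sq V y)"
proof -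
  define K where "K = {x :: 'a \<Rightarrow> real. \<forall>i. x i \<in> (if i \<in> V then {-1..1} else {0})}
                        \<inter> {x. sum_sq V x = 1}"
  have cont: "continuous_on UNIV (sum_sq V)" "continuous_on UNIV (quad V A)"
    unfolding sum_sq_def pairing_def by (intro continuous_intros continuous_on_product_coordinates)+
  have "closed {x. sum_sq V x = 1}"
    using cont(1) by (intro closed_Collect_eq continuous_on_const)
  then have "compact K"
    unfolding K_def by (intro compact_Int_closed compact_box_functions)
  moreover obtain u0 where "u0 \<in> V"
    using assms(2) by auto
  then have "(\<lambda>w. if w = u0 then 1 else 0) \<in> K"
    using assms(1) by (auto simp: K_def sum_sq_def if_distrib[of "\<lambda>z. z\<^sup>2"] cong: if_cong)
  ultimately obtain x where x: "x \<in> K" "\<And>y. y \<in> K \<Longrightarrow> quad V A y \<le> quad V A x"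
    using continuous_attains_sup[of K "quad V A"] cont(2) continuous_on_subset by blast
  define l where "l = quad V A x"
  have x1: "sum_sq V x = 1"
    using x(1) by (simp add: K_def)
  have le: "quad V A y \<le> l * sum_sq V y" for y
  proof (cases "sum_sq V y = 0")
    case True
    then have "\<And>v. v \<in> V \<Longrightarrow> y v = 0"
      using assms(1) by (simp add: sum_sq_def sum_nonneg_eq_0_iff)
    then show ?thesis
      using True by (simp add: pairing_def)
  next
    case False
    define r where "r = sqrt (sum_sq V y)"
    have s0: "0 < sum_sq V y"
      using False sum_nonneg[of V "\<lambda>v. (y v)\<^sup>2"] by (simp add: sum_sq_def)
    then have r: "r > 0" "r\<^sup>2 = sum_sq V y"
      by (auto simp: r_def)
    define z where "z w = (if w \<in> V then y w / r else 0)" for w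
    have z1: "sum_sq V z = 1"
      using r s0 by (simp add: sum_sq_def z_def power_divide flip: sum_divide_distrib)
    have "\<bar>z w\<bar> \<le> 1" if "w \<in> V" for w
    proof -
      have "(z w)\<^sup>2 \<le> sum_sq V z"
        unfolding sum_sq_def using that assms(1) by (intro member_le_sum) auto
      then show ?thesis
        using z1 by (simp add: abs_square_le_1)
    qed
    then have "z \<in> K"
      using z1 by (auto simp: K_def abs_le_iff minus_le_iff) (simp add: z_def)
    then have "quad V A z \<le> l"
      using x(2) by (simp add: l_def)
    also have "quad V A z = quad V A y / r\<^sup>2"
      by (simp add: pairing_def z_def power2_eq_square sum_divide_distrib)
    finally show ?thesis
      using r s0 by (simp add: field_simps)
  qed
  have eig: "(\<Sum>v\<in>V. A u v * x v) = l * x u" if u: "u \<in> V" for u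
  proof -
    let ?d = "\<lambda>w. if w = u then 1 else 0 :: real"
    define a where "a = l * x u - (\<Sum>v\<in>V. A u v * x v)"
    have sq: "sum_sq V (\<lambda>w. x w + e * ?d w) = 1 + 2 * e * x u + e\<^sup>2" for e
    proof -
      have "sum_sq V (\<lambda>w. x w + e * ?d w)
          = (\<Sum>w\<in>V. (x w)\<^sup>2 + (if w = u then 2 * e * x u + e\<^sup>2 else 0))"
        unfolding sum_sq_def by (intro sum.cong) (auto simp: power2_eq_square algebra_simps)
      then show ?thesis
        using x1 u assms(1) by (simp add: sum.distrib sum_sq_def)
    qed
    have qd: "quad V A (\<lambda>w. x w + e * ?d w) = l + 2 * e * (\<Sum>v\<in>V. A u v * x v) + e\<^sup>2 * A u u" for e
    proof -
      have "quad V A (\<lambda>w. x w + e * ?d w)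
        = (\<Sum>p\<in>V. \<Sum>q\<in>V. A p q * (x p * x q) + (if p = u then e * A u q * x q else 0)
            + (if q = u then e * A p u * x p + (if p = u then e\<^sup>2 * A u u else 0) else 0))"
        unfolding pairing_def by (intro sum.cong) (auto simp: power2_eq_square algebra_simps)
      also have "\<dots> = quad V A x + (\<Sum>q\<in>V. e * A u q * x q) + (\<Sum>p\<in>V. e * A p u * x p) + e\<^sup>2 * A u u"
      proof -
        have "(\<Sum>p\<in>V. \<Sum>q\<in>V. if p = u then e * A u q * x q else 0) = (\<Sum>q\<in>V. e * A u q * x q)"
          using u assms(1) by (subst sum.swap) simp
        then show ?thesis
          using u assms(1) by (simp add: sum.distrib pairing_def)
      qed
      also have "(\<Sum>p\<in>V. e * A p u * x p) = (\<Sum>q\<in>V. e * A u q * x q)"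
        using u assms(3) by (intro sum.cong) (auto simp: sym_mat_def)
      finally show ?thesis
        by (simp add: l_def sum_distrib_left mult.assoc)
    qed
    have *: "0 \<le> 2 * e * a + e\<^sup>2 * (l - A u u)" for e
      using le[of "\<lambda>w. x w + e * ?d w"] unfolding sq qd by (simp add: a_def algebra_simps)
    have "0 \<le> a"
      by (rule nonneg_slope_if_min[of _ "l - A u u"]) (use * in auto)
    moreover have "0 \<le> - a"
      by (rule nonneg_slope_if_min[of _ "l - A u u"]) (use *[of "- _"] in auto)
    ultimately show ?thesis
      by (simp add: a_def)
  qed
  show ?thesis
    using x1 eig le by (intro exI conjI ballI allI)
qed

text \<open>
  Take \<open>P\<close> in the cone whose restriction to \<open>S\<close> is closest to \<open>b\<close>, and let \<open>C\<close> be the difference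
  \<open>P - b\<close> on \<open>S\<close>. Optimality of \<open>P\<close> under adding elements of the cone says that \<open>C\<close> is in the dual cone;
  optimality under scaling \<open>P\<close> says that \<open>C\<close> is orthogonal to \<open>P\<close>. Hence the pairing of \<open>C\<close> with \<open>b\<close> is
  \<open>- sum of squares of C\<close>, which is negative unless the distance is zero. The distance is attained because
  \<open>S\<close> contains the diagonal: a bounded distance bounds the diagonal of a positive semidefinite matrix, and
  thereby all its entries.
\<close>

lemma conic_alternative:
  assumes fin: "finite V" and S: "S \<subseteq> V \<times> V" "\<And>v. v \<in> V \<Longrightarrow> (v, v) \<in> S" "sym S"
    and b: "\<And>u v. b u v = b v u"
  obtains (primal) P where "dual_psd V P" "\<And>u v. (u, v) \<in> S \<Longrightarrow> P u v = b u v"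
  | (dual) C where "psd V C" "\<And>u v. (u, v) \<notin> S \<Longrightarrow> C u v = 0" "pairing V C b < 0"
proof -
  define F where "F P = (\<Sum>(u, v)\<in>S. (P u v - b u v)\<^sup>2)" for P
  have finS: "finite S"
    using S(1) fin finite_subset by blast
  \<comment> \<open>no entry of a competitor at least as good as the zero matrix exceeds this bound\<close>
  define R where "R = (\<Sum>v\<in>V. \<bar>b v v\<bar>) + F (\<lambda>_ _. 0) + 1"
  define K where "K = {f. \<forall>i. f i \<in> (if i \<in> V \<times> V then {-R..R} else {0::real})}
                       \<inter> {f. dual_psd V (curry f)}"
  have F0: "0 \<le> F P" for P
    unfolding F_def by (intro sum_nonneg) auto
  have "closed {f :: 'a \<times> 'a \<Rightarrow> real. dual_psd V (curry f)}"
  proof -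
    have "{f :: 'a \<times> 'a \<Rightarrow> real. dual_psd V (curry f)}
       = (\<Inter>u\<in>V. \<Inter>v\<in>V. {f. f (u, v) = f (v, u)}) \<inter> (\<Inter>R\<in>Collect (psd V). {f. 0 \<le> pairing V (curry f) R})"
      by (auto simp: dual_psd_def sym_mat_def)
    moreover have "closed {f :: 'a \<times> 'a \<Rightarrow> real. f (u, v) = f (v, u)}" for u v
      by (intro closed_Collect_eq continuous_on_product_coordinates)
    moreover have "closed {f :: 'a \<times> 'a \<Rightarrow> real. 0 \<le> pairing V (curry f) R}" for R
      unfolding pairing_def curry_def
      by (intro closed_Collect_le continuous_intros continuous_on_product_coordinates)
    ultimately show ?thesis
      by (auto intro!: closed_INT closed_Int)
  qed
  then have "compact K"
    unfolding K_def by (intro compact_Int_closed compact_box_functions)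
  moreover have zero: "(\<lambda>_. 0) \<in> K"
  proof -
    have "0 \<le> R"
      unfolding R_def using F0 by (intro add_nonneg_nonneg sum_nonneg) auto
    then show ?thesis
      using dual_psd_scale[OF order_refl dual_psd_rank_one, of V] by (simp add: K_def curry_def)
  qed
  moreover have "continuous_on K (\<lambda>f. F (curry f))"
    unfolding F_def curry_def case_prod_unfold
    by (intro continuous_intros continuous_on_subset[OF continuous_on_product_coordinates]) auto
  ultimately obtain f where f: "f \<in> K" "\<And>g. g \<in> K \<Longrightarrow> F (curry f) \<le> F (curry g)"
    using continuous_attains_inf[of K "\<lambda>f. F (curry f)"] by blast
  define P where "P = curry f"
  have P: "dual_psd V P"
    using f(1) by (simp add: K_def P_def)
  have min: "F P \<le> F Q" if Q: "dual_psd V Q" for Q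
  proof (cases "F Q \<le> F (\<lambda>_ _. 0)")
    case False
    then show ?thesis
      using f(2)[OF zero] by (simp add: P_def curry_def)
  next
    case True
    have diag: "Q v v \<le> R" if v: "v \<in> V" for v
    proof -
      have "(Q v v - b v v)\<^sup>2 \<le> F Q"
        unfolding F_def using member_le_sum[OF S(2)[OF v], of "\<lambda>(u, v). (Q u v - b u v)\<^sup>2"] finS
        by auto
      also note True
      finally have "(Q v v - b v v)\<^sup>2 \<le> F (\<lambda>_ _. 0)" .
      moreover have "Q v v - b v v \<le> (Q v v - b v v)\<^sup>2 + 1"
      proof -
        have "0 \<le> (Q v v - b v v - 1/2)\<^sup>2"
          by simp
        also have "\<dots> = (Q v v - b v v)\<^sup>2 - (Q v v - b v v) + 1/4"
          by (simp add: power2_eq_square algebra_simps)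
        finally show ?thesis
          by simp
      qed
      moreover have "\<bar>b v v\<bar> \<le> (\<Sum>v\<in>V. \<bar>b v v\<bar>)"
        using fin v by (intro member_le_sum) auto
      ultimately show ?thesis
        by (simp add: R_def)
    qed
    \<comment> \<open>\<open>K\<close> only contains matrices that vanish outside \<open>V\<close>\<close>
    define Q' where "Q' u v = (if u \<in> V \<and> v \<in> V then Q u v else 0)" for u v
    have "dual_psd V Q'"
      using Q by (simp add: dual_psd_def sym_mat_def pairing_def Q'_def)
    moreover have "\<bar>Q u v\<bar> \<le> R" if "u \<in> V" "v \<in> V" for u v
      using psd_entry_bound[OF fin dual_psd_imp_psd[OF Q] that] diag[OF that(1)] diag[OF that(2)]
      by linarith
    ultimately have "case_prod Q' \<in> K"
      by (auto simp: K_def abs_le_iff minus_le_iff) (auto simp: Q'_def)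
    then have "F P \<le> F Q'"
      using f(2) by (force simp: P_def)
    also have "F Q' = F Q"
      unfolding F_def using S(1) by (intro sum.cong) (auto simp: Q'_def)
    finally show ?thesis .
  qed
  define C where "C u v = (if (u, v) \<in> S then P u v - b u v else 0)" for u v
  have pS: "pairing V C Q = (\<Sum>(u, v)\<in>S. (P u v - b u v) * Q u v)" for Q
  proof -
    have "pairing V C Q = (\<Sum>p\<in>V \<times> V. C (fst p) (snd p) * Q (fst p) (snd p))"
      by (simp add: pairing_def sum.cartesian_product case_prod_unfold)
    also have "\<dots> = (\<Sum>p\<in>S. C (fst p) (snd p) * Q (fst p) (snd p))"
      using S(1) fin by (intro sum.mono_neutral_right) (auto simp: C_def)
    finally show ?thesis
      by (simp add: C_def case_prod_unfold)
  qed
  have expand: "F (\<lambda>u v. P u v + e * Q u v) = F P + (2 * e * pairing V C Q + e\<^sup>2 * (\<Sum>(u, v)\<in>S. (Q u v)\<^sup>2))"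
    for e Q
  proof -
    have "F (\<lambda>u v. P u v + e * Q u v)
      = (\<Sum>(u, v)\<in>S. (P u v - b u v)\<^sup>2 + (2 * e * ((P u v - b u v) * Q u v) + e\<^sup>2 * (Q u v)\<^sup>2))"
      unfolding F_def by (intro sum.cong) (auto simp: power2_eq_square algebra_simps)
    then show ?thesis
      unfolding pS F_def by (simp add: case_prod_unfold sum.distrib sum_distrib_left)
  qed
  \<comment> \<open>\<open>C\<close> is half the gradient of \<open>F\<close> at \<open>P\<close>\<close>
  have C_dual: "0 \<le> pairing V C Q" if Q: "dual_psd V Q" for Q
  proof (rule nonneg_slope_if_min)
    fix e :: real assume "0 < e"
    then have "F P \<le> F (\<lambda>u v. P u v + e * Q u v)"
      using P Q by (intro min dual_psd_add dual_psd_scale) auto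
    then show "0 \<le> 2 * e * pairing V C Q + e\<^sup>2 * (\<Sum>(u, v)\<in>S. (Q u v)\<^sup>2)"
      unfolding expand by simp
  qed
  have C_P: "pairing V C P = 0"
  proof -
    have "0 \<le> - pairing V C P"
    proof (rule nonneg_slope_if_min)
      fix e :: real assume "e \<le> 1"
      then have "F P \<le> F (\<lambda>u v. (1 - e) * P u v)"
        using P by (intro min dual_psd_scale) auto
      also have "(\<lambda>u v. (1 - e) * P u v) = (\<lambda>u v. P u v + (- e) * P u v)"
        by (simp add: algebra_simps)
      finally show "0 \<le> 2 * e * (- pairing V C P) + e\<^sup>2 * (\<Sum>(u, v)\<in>S. (P u v)\<^sup>2)"
        unfolding expand by simp
    qed
    with C_dual[OF P] show ?thesis
      by simp
  qed
  have C_b: "pairing V C b = - F P"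
  proof -
    have "F P = pairing V C (\<lambda>u v. P u v - b u v)"
      unfolding pS F_def by (simp add: power2_eq_square)
    also have "\<dots> = pairing V C P - pairing V C b"
      by (simp add: pairing_def right_diff_distrib sum_subtractf)
    finally show ?thesis
      using C_P by simp
  qed
  show thesis
  proof (cases "F P = 0")
    case True
    then have "\<forall>p\<in>S. (case p of (u, v) \<Rightarrow> (P u v - b u v)\<^sup>2) = 0"
      unfolding F_def using finS by (subst (asm) sum_nonneg_eq_0_iff) auto
    then show ?thesis
      using primal[OF P] by force
  next
    case False
    have "sym_mat V C"
      using P b S(3) by (auto simp: C_def sym_mat_def dual_psd_def sym_def)
    then have "psd V C"
      using C_dual[OF dual_psd_rank_one] by (simp add: psd_def)
    moreover have "pairing V C b < 0"
      using C_b False F0[of P] by simp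
    ultimately show ?thesis
      using dual[of C] by (simp add: C_def)
  qed
qed

section \<open>Chebyshev polynomials of a matrix\<close>

text \<open>
  The Chebyshev polynomials of a matrix \<open>A\<close> enter only through their action on a vector \<open>x\<close>, and both
  families satisfy the recurrence \<open>y (j + 2) = 2 A y (j + 1) - y j\<close>. The family \<open>cheb_T\<close> is the first
  kind, \<open>T j (cos \<phi>) = cos (j \<phi>)\<close>. The family \<open>cheb_V\<close> is the third kind,
  \<open>V j (cos \<phi>) = cos ((j + 1/2) \<phi>) / cos (\<phi> / 2)\<close>, which starts with \<open>1\<close> and \<open>2 x - 1\<close>.
\<close>

definition mat_vec :: "'a set \<Rightarrow> ('a \<Rightarrow> 'a \<Rightarrow> real) \<Rightarrow> ('a \<Rightarrow> real) \<Rightarrow> 'a \<Rightarrow> real" where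
  "mat_vec V A x = (\<lambda>u. \<Sum>v\<in>V. A u v * x v)"

definition inner_on :: "'a set \<Rightarrow> ('a \<Rightarrow> real) \<Rightarrow> ('a \<Rightarrow> real) \<Rightarrow> real" where
  "inner_on V x y = (\<Sum>v\<in>V. x v * y v)"

fun cheb_T :: "'a set \<Rightarrow> ('a \<Rightarrow> 'a \<Rightarrow> real) \<Rightarrow> nat \<Rightarrow> ('a \<Rightarrow> real) \<Rightarrow> 'a \<Rightarrow> real" where
  "cheb_T V A 0 x = x"
| "cheb_T V A (Suc 0) x = mat_vec V A x"
| "cheb_T V A (Suc (Suc j)) x = (\<lambda>u. 2 * mat_vec V A (cheb_T V A (Suc j) x) u - cheb_T V A j x u)"

fun cheb_V :: "'a set \<Rightarrow> ('a \<Rightarrow> 'a \<Rightarrow> real) \<Rightarrow> nat \<Rightarrow> ('a \<Rightarrow> real) \<Rightarrow> 'a \<Rightarrow> real" where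
  "cheb_V V A 0 x = x"
| "cheb_V V A (Suc 0) x = (\<lambda>u. 2 * mat_vec V A x u - x u)"
| "cheb_V V A (Suc (Suc j)) x = (\<lambda>u. 2 * mat_vec V A (cheb_V V A (Suc j) x) u - cheb_V V A j x u)"

lemma mat_vec_add: "mat_vec V A (\<lambda>u. x u + y u) = (\<lambda>w. mat_vec V A x w + mat_vec V A y w)"
  by (simp add: mat_vec_def distrib_left sum.distrib)

lemma mat_vec_diff: "mat_vec V A (\<lambda>u. x u - y u) = (\<lambda>w. mat_vec V A x w - mat_vec V A y w)"
  by (simp add: mat_vec_def right_diff_distrib sum_subtractf)

lemma mat_vec_scale: "mat_vec V A (\<lambda>u. c * x u) = (\<lambda>w. c * mat_vec V A x w)"
  by (simp add: mat_vec_def sum_distrib_left mult.left_commute)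

lemmas mat_vec_linear = mat_vec_add mat_vec_diff mat_vec_scale

lemma inner_on_add_left: "inner_on V (\<lambda>u. x u + y u) z = inner_on V x z + inner_on V y z"
  by (simp add: inner_on_def distrib_right sum.distrib)

lemma inner_on_diff_left: "inner_on V (\<lambda>u. x u - y u) z = inner_on V x z - inner_on V y z"
  by (simp add: inner_on_def left_diff_distrib sum_subtractf)

lemma inner_on_scale_left: "inner_on V (\<lambda>u. c * x u) z = c * inner_on V x z"
  by (simp add: inner_on_def sum_distrib_left mult.assoc)

lemma inner_on_diff_right: "inner_on V z (\<lambda>u. x u - y u) = inner_on V z x - inner_on V z y"
  by (simp add: inner_on_def right_diff_distrib sum_subtractf)

lemma inner_on_scale_right: "inner_on V z (\<lambda>u. c * x u) = c * inner_on V z x"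
  by (simp add: inner_on_def sum_distrib_left mult.left_commute)

lemmas inner_on_linear = inner_on_add_left inner_on_diff_left inner_on_scale_left
  inner_on_diff_right inner_on_scale_right

lemma inner_on_self: "inner_on V x x = sum_sq V x"
  by (simp add: inner_on_def sum_sq_def power2_eq_square)

lemma inner_on_mat_vec: "inner_on V (mat_vec V A x) x = quad V A x"
  by (simp add: inner_on_def mat_vec_def pairing_def sum_distrib_left algebra_simps)

lemma mat_vec_selfadjoint:
  assumes "sym_mat V A"
  shows "inner_on V x (mat_vec V A y) = inner_on V (mat_vec V A x) y"
proof -
  have "inner_on V x (mat_vec V A y) = (\<Sum>u\<in>V. \<Sum>v\<in>V. x u * A u v * y v)"
    by (simp add: inner_on_def mat_vec_def sum_distrib_left mult.assoc)
  also have "\<dots> = (\<Sum>v\<in>V. \<Sum>u\<in>V. x u * A u v * y v)"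
    by (rule sum.swap)
  also have "\<dots> = (\<Sum>v\<in>V. \<Sum>u\<in>V. A v u * x u * y v)"
    using assms by (intro sum.cong) (auto simp: sym_mat_def)
  also have "\<dots> = inner_on V (mat_vec V A x) y"
    by (simp add: inner_on_def mat_vec_def sum_distrib_right)
  finally show ?thesis .
qed

text \<open>
  The polynomial identity \<open>(1 + x) V i = T (i + 1) + T i\<close>.
\<close>

lemma cheb_V_times_one_plus:
  "cheb_V V A i x u + mat_vec V A (cheb_V V A i x) u = cheb_T V A (Suc i) x u + cheb_T V A i x u"
proof (induction i arbitrary: u rule: induct_nat_012)
  case (ge2 n)
  have IH: "mat_vec V A (cheb_V V A (Suc n) x)
      = (\<lambda>u. cheb_T V A (Suc (Suc n)) x u + cheb_T V A (Suc n) x u - cheb_V V A (Suc n) x u)"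
    using ge2(2) by (intro ext) (metis add_diff_cancel_left' add.commute)
  show ?case
    using ge2(1)[of u]
    unfolding cheb_V.simps(3)[of V A n] cheb_T.simps(3)[of V A "Suc n"] mat_vec_linear IH
    by (simp add: mat_vec_linear)
qed (simp_all add: mat_vec_linear)

text \<open>
  The polynomial identity \<open>(1 + x) V i V j = T (i + j + 1) + T (i - j)\<close>, evaluated at \<open>A\<close> and read as a
  quadratic form. Since \<open>A\<close> is self-adjoint, \<open>2 A\<close> may be applied to either argument; by the recurrence,
  the left-hand side \<open>f i j\<close> then satisfies \<open>f i (j + 1) + f i (j - 1) = f (i + 1) j + f (i - 1) j\<close>,
  which carries the formula from one \<open>j\<close> to the next.
\<close>

lemma cheb_product:
  assumes "sym_mat V A" "j \<le> i"
  shows "inner_on V (\<lambda>u. cheb_V V A i x u + mat_vec V A (cheb_V V A i x) u) (cheb_V V A j x)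
       = inner_on V (cheb_T V A (i + j + 1) x) x + inner_on V (cheb_T V A (i - j) x) x"
proof -
  let ?f = "\<lambda>i y. inner_on V (\<lambda>u. cheb_V V A i x u + mat_vec V A (cheb_V V A i x) u) y"
  let ?g = "\<lambda>l. inner_on V (cheb_T V A l x) x"
  have shift: "2 * ?f (Suc i) (mat_vec V A y) = ?f (Suc (Suc i)) y + ?f i y" for i y
  proof -
    have "2 * ?f (Suc i) (mat_vec V A y)
        = inner_on V (\<lambda>u. 2 * mat_vec V A (\<lambda>u. cheb_V V A (Suc i) x u + mat_vec V A (cheb_V V A (Suc i) x) u) u) y"
      by (simp only: mat_vec_selfadjoint[OF assms(1)] mat_vec_linear inner_on_linear)
    also have "\<dots> = ?f (Suc (Suc i)) y + ?f i y"
      by (simp only: cheb_V.simps(3) mat_vec_linear flip: inner_on_add_left)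
        (simp add: algebra_simps)
    finally show ?thesis .
  qed
  have base: "?f i x = ?g (Suc i) + ?g i" for i
    by (simp only: cheb_V_times_one_plus inner_on_linear)
  show ?thesis
    using assms(2)
  proof (induction j arbitrary: i rule: induct_nat_012)
    case 0
    then show ?case
      using base by simp
  next
    case 1
    then obtain m where i: "i = Suc m"
      by (cases i) auto
    show ?case
      using shift[of m x] base[of i] base[of m] base[of "Suc (Suc m)"]
      by (simp add: inner_on_linear i del: cheb_T.simps(3) cheb_V.simps)
        (simp add: inner_on_linear)
  next
    case (ge2 n)
    then obtain m where i: "i = Suc m" "Suc n \<le> m"
      by (cases i) auto
    have "?f i (cheb_V V A (Suc (Suc n)) x) = 2 * ?f i (mat_vec V A (cheb_V V A (Suc n) x)) - ?f i (cheb_V V A n x)"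
      unfolding cheb_V.simps(3)[of V A n] by (simp only: inner_on_diff_right inner_on_scale_right)
    also have "\<dots> = ?f (Suc i) (cheb_V V A (Suc n) x) + ?f m (cheb_V V A (Suc n) x) - ?f i (cheb_V V A n x)"
      unfolding i shift ..
    also have "\<dots> = ?g (i + Suc (Suc n) + 1) + ?g (i - Suc (Suc n))"
    proof -
      have "?f (Suc i) (cheb_V V A (Suc n) x) = ?g (i + Suc (Suc n) + 1) + ?g (i - n)"
        using ge2(2)[of "Suc i"] ge2(3) by simp
      moreover have "?f m (cheb_V V A (Suc n) x) = ?g (i + n + 1) + ?g (i - Suc (Suc n))"
        using ge2(2)[of m] i by simp
      moreover have "?f i (cheb_V V A n x) = ?g (i + n + 1) + ?g (i - n)"
        using ge2(1)[of i] ge2(3) by simp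
      ultimately show ?thesis
        by simp
    qed
    finally show ?case .
  qed
qed

text \<open>
  For \<open>d = 2 m + 1\<close> the case \<open>i = j = m\<close> of the product formula reads \<open>1 + T d = (1 + x) (V m)\<^sup>2\<close>, so
  \<open>1 + A \<ge> 0\<close> implies \<open>1 + T d A \<ge> 0\<close>.
\<close>

lemma odd_cheb_T_ge:
  assumes "sym_mat V A" "\<And>y. 0 \<le> sum_sq V y + quad V A y" "odd d"
  shows "0 \<le> inner_on V (cheb_T V A d x) x + sum_sq V x"
proof -
  obtain m where d: "d = m + m + 1"
    using \<open>odd d\<close> by (metis oddE mult_2)
  let ?y = "cheb_V V A m x"
  have "0 \<le> sum_sq V ?y + quad V A ?y"
    by (rule assms(2))
  also have "\<dots> = inner_on V (\<lambda>u. ?y u + mat_vec V A ?y u) ?y"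
    by (simp add: inner_on_linear inner_on_self inner_on_mat_vec)
  also have "\<dots> = inner_on V (cheb_T V A d x) x + sum_sq V x"
    using cheb_product[OF assms(1) order_refl, of m x] by (simp add: d inner_on_self)
  finally show ?thesis .
qed

lemma cheb_T_eigenvector:
  assumes "\<And>u. u \<in> V \<Longrightarrow> mat_vec V A x u = cosh t * x u" "u \<in> V"
  shows "cheb_T V A j x u = cosh (real j * t) * x u"
  using assms(2)
proof (induction j arbitrary: u rule: induct_nat_012)
  case 1
  then show ?case
    using assms(1) by simp
next
  case (ge2 n)
  have "mat_vec V A (cheb_T V A (Suc n) x) u = mat_vec V A (\<lambda>v. cosh (real (Suc n) * t) * x v) u"
    unfolding mat_vec_def using ge2(2) by (intro sum.cong) auto
  also have "\<dots> = cosh (real (Suc n) * t) * (cosh t * x u)"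
    using assms(1) ge2(3) by (simp add: mat_vec_scale)
  finally have "cheb_T V A (Suc (Suc n)) x u
      = (2 * cosh (real (Suc n) * t) * cosh t - cosh (real n * t)) * x u"
    using ge2 by (simp add: algebra_simps)
  also have "2 * cosh (real (Suc n) * t) * cosh t = cosh (real (Suc n) * t + t) + cosh (real (Suc n) * t - t)"
    by (simp add: cosh_add cosh_diff)
  finally show ?case
    by (simp add: algebra_simps)
qed simp

definition unit_vec :: "'a \<Rightarrow> 'a \<Rightarrow> real" where
  "unit_vec w = (\<lambda>u. if u = w then 1 else 0)"

lemma cheb_T_expand:
  assumes "finite V" "u \<in> V"
  shows "cheb_T V A j x u = (\<Sum>w\<in>V. x w * cheb_T V A j (unit_vec w) u)"
proof -
  have mv: "mat_vec V A y u = (\<Sum>w\<in>V. x w * mat_vec V A (z w) u)"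
    if "\<And>v. v \<in> V \<Longrightarrow> y v = (\<Sum>w\<in>V. x w * z w v)" for y z u
  proof -
    have "mat_vec V A y u = (\<Sum>v\<in>V. \<Sum>w\<in>V. x w * (A u v * z w v))"
      unfolding mat_vec_def using that by (intro sum.cong) (auto simp: sum_distrib_left algebra_simps)
    also have "\<dots> = (\<Sum>w\<in>V. \<Sum>v\<in>V. x w * (A u v * z w v))"
      by (rule sum.swap)
    finally show ?thesis
      by (simp add: mat_vec_def sum_distrib_left)
  qed
  have e: "x v = (\<Sum>w\<in>V. x w * unit_vec w v)" if "v \<in> V" for v
    using that assms(1) by (simp add: unit_vec_def if_distrib cong: if_cong)
  show ?thesis
    using assms(2)
  proof (induction j arbitrary: u rule: induct_nat_012)
    case 0
    then show ?case
      using e by simp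
  next
    case 1
    show ?case
      using mv[OF e] by simp
  next
    case (ge2 n)
    have "mat_vec V A (cheb_T V A (Suc n) x) u
        = (\<Sum>w\<in>V. x w * mat_vec V A (cheb_T V A (Suc n) (unit_vec w)) u)"
      using ge2(2) by (rule mv)
    then show ?case
      using ge2(1)[OF ge2(3)] by (simp add: right_diff_distrib sum_subtractf sum_distrib_left mult.left_commute)
  qed
qed

text \<open>
  \<open>T j\<close> has the parity of \<open>j\<close>, and entry \<open>(u, w)\<close> of a power \<open>A ^ i\<close> is a sum over walks of length \<open>i\<close>
  from \<open>u\<close> to \<open>w\<close>.
\<close>

lemma cheb_T_support:
  assumes E: "\<And>u v. u \<in> V \<Longrightarrow> v \<in> V \<Longrightarrow> A u v \<noteq> 0 \<Longrightarrow> (u, v) \<in> E"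
    and "u \<in> V" "w \<in> V" "cheb_T V A j (unit_vec w) u \<noteq> 0"
  shows "\<exists>i\<le>j. even i = even j \<and> (u, w) \<in> E ^^ i"
  using assms(2-)
proof (induction j arbitrary: u rule: induct_nat_012)
  case 0
  then show ?case
    by (auto simp: unit_vec_def split: if_splits)
next
  case 1
  then obtain v where "v \<in> V" "A u v * unit_vec w v \<noteq> 0"
    unfolding cheb_T.simps mat_vec_def by (meson sum.neutral)
  then have "(u, w) \<in> E"
    using E[OF 1(1,2)] by (auto simp: unit_vec_def split: if_splits)
  then have "(u, w) \<in> E ^^ Suc 0"
    by simp
  then show ?case
    by blast
next
  case (ge2 n)
  show ?case
  proof (cases "cheb_T V A n (unit_vec w) u = 0")
    case False
    then obtain i where "i \<le> n" "even i = even n" "(u, w) \<in> E ^^ i"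
      using ge2(1)[OF ge2(3,4)] by blast
    then show ?thesis
      by (intro exI[of _ i]) auto
  next
    case True
    then have "mat_vec V A (cheb_T V A (Suc n) (unit_vec w)) u \<noteq> 0"
      using ge2(5) by auto
    then obtain v where v: "v \<in> V" "A u v * cheb_T V A (Suc n) (unit_vec w) v \<noteq> 0"
      unfolding mat_vec_def by (meson sum.neutral)
    then obtain i where i: "i \<le> Suc n" "even i = even (Suc n)" "(v, w) \<in> E ^^ i"
      using ge2(2)[OF v(1) ge2(4)] by auto
    moreover have "(u, v) \<in> E"
      using E[OF ge2(3) v(1)] v(2) by auto
    ultimately show ?thesis
      using relpow_Suc_I2[of u v E w i] by (intro exI[of _ "Suc i"]) auto
  qed
qed

section \<open>Graphs of large odd girth\<close>

text \<open>
  If the largest eigenvalue were \<open>cosh s\<close> with \<open>s > t\<close>, then \<open>1 + T d A\<close> would be positive semidefinite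
  with unit diagonal and have an eigenvalue \<open>1 + cosh (d * s)\<close> larger than its trace.
\<close>

lemma quad_le_cosh:
  assumes fin: "finite V" "V \<noteq> {}" and A: "sym_mat V A"
    and E: "\<And>u v. u \<in> V \<Longrightarrow> v \<in> V \<Longrightarrow> A u v \<noteq> 0 \<Longrightarrow> (u, v) \<in> E"
    and no_walk: "\<And>u j. odd j \<Longrightarrow> j \<le> d \<Longrightarrow> (u, u) \<notin> E ^^ j"
    and "odd d" and low: "\<And>y. 0 \<le> sum_sq V y + quad V A y"
    and "0 \<le> t" and card: "real (card V) - 1 \<le> cosh (real d * t)"
  shows "quad V A y \<le> cosh t * sum_sq V y"
proof -
  obtain x l where x: "sum_sq V x = 1" "\<forall>u\<in>V. (\<Sum>v\<in>V. A u v * x v) = l * x u"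
    and l: "\<forall>y. quad V A y \<le> l * sum_sq V y"
    using top_eigenvector[OF fin A] by (elim exE conjE) (rule that)
  have "l \<le> cosh t"
  proof (rule ccontr)
    assume "\<not> l \<le> cosh t"
    then have lt: "cosh t < l"
      by simp
    define s where "s = arcosh l"
    have "1 \<le> l"
      using lt cosh_real_ge_1[of t] by linarith
    then have s: "0 \<le> s" "cosh s = l"
      by (simp_all add: s_def)
    then have "t < s"
      using lt \<open>0 \<le> t\<close> cosh_real_nonneg_less_iff by blast
    moreover have "d > 0"
      using \<open>odd d\<close> by (rule odd_pos)
    ultimately have "cosh (real d * t) < cosh (real d * s)"
      using \<open>0 \<le> t\<close> s by (subst cosh_real_nonneg_less_iff) auto
    with card have big: "real (card V) - 1 < cosh (real d * s)"
      by simp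
    \<comment> \<open>\<open>N\<close> is the matrix \<open>T d A\<close>, and \<open>M\<close> is \<open>1 + T d A\<close>, symmetrised by averaging with the transpose\<close>
    define N where "N u w = cheb_T V A d (unit_vec w) u" for u w
    define M where "M u w = (N u w + N w u) / 2 + (if u = w then 1 else 0)" for u w
    have N: "quad V N z = inner_on V (cheb_T V A d z) z" for z
    proof -
      have "inner_on V (cheb_T V A d z) z = (\<Sum>u\<in>V. (\<Sum>w\<in>V. z w * N u w) * z u)"
        unfolding inner_on_def N_def using cheb_T_expand[OF fin(1)] by (intro sum.cong) auto
      then show ?thesis
        by (simp add: pairing_def sum_distrib_left sum_distrib_right algebra_simps)
    qed
    have M: "quad V M z = inner_on V (cheb_T V A d z) z + sum_sq V z" for z
    proof -
      have "quad V M z = (\<Sum>u\<in>V. \<Sum>w\<in>V. (N u w * (z u * z w) + N w u * (z u * z w)) / 2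
                                        + (if w = u then (z u)\<^sup>2 else 0))"
        unfolding pairing_def
      proof (intro sum.cong refl)
        fix u w
        show "M u w * (z u * z w) = (N u w * (z u * z w) + N w u * (z u * z w)) / 2
                                        + (if w = u then (z u)\<^sup>2 else 0)"
          by (cases "w = u") (simp_all add: M_def power2_eq_square distrib_right)
      qed
      also have "\<dots> = (quad V N z + quad V (\<lambda>u w. N w u) z) / 2 + sum_sq V z"
        using fin(1) by (simp add: sum.distrib pairing_def sum_sq_def flip: sum_divide_distrib)
      also have "quad V (\<lambda>u w. N w u) z = quad V N z"
        unfolding pairing_def by (subst sum.swap) (simp add: mult.commute)
      finally show ?thesis
        by (simp add: N)
    qed
    have "psd V M"
      unfolding psd_def sym_mat_def
    proof (intro conjI ballI allI)
      show "0 \<le> quad V M z" for z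
        unfolding M by (rule odd_cheb_T_ge[OF A low \<open>odd d\<close>])
    qed (auto simp: M_def add.commute)
    moreover have "M u u = 1" if "u \<in> V" for u
    proof -
      have "N u u = 0"
        using cheb_T_support[where E = E, OF E that that] no_walk \<open>odd d\<close> unfolding N_def by blast
      then show ?thesis
        by (simp add: M_def)
    qed
    ultimately have "quad V M x \<le> card V"
      using psd_unit_diag_quad_le[OF fin(1), of M x] x(1) by simp
    moreover have "inner_on V (cheb_T V A d x) x = cosh (real d * s)"
    proof -
      have "cheb_T V A d x u = cosh (real d * s) * x u" if "u \<in> V" for u
        using that by (intro cheb_T_eigenvector) (simp_all add: mat_vec_def x s)
      then have "inner_on V (cheb_T V A d x) x = inner_on V (\<lambda>u. cosh (real d * s) * x u) x"
        unfolding inner_on_def by (intro sum.cong) auto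
      then show ?thesis
        using x(1) by (simp add: inner_on_scale_left inner_on_self)
    qed
    ultimately show False
      using big x(1) by (simp add: M)
  qed
  then have "l * sum_sq V y \<le> cosh t * sum_sq V y"
    by (intro mult_right_mono) (auto simp: sum_sq_def intro: sum_nonneg)
  with l[rule_format, of y] show ?thesis
    by simp
qed

text \<open>
  Write \<open>C = D (1 + A) D\<close> with \<open>D\<close> the diagonal matrix of the square roots \<open>r u\<close> of the diagonal of \<open>C\<close>.
  The sum of all entries of \<open>C\<close> is the quadratic form of \<open>1 + A\<close> at \<open>r\<close>, and the trace of \<open>C\<close> is the
  squared norm of \<open>r\<close>, so the claim is the eigenvalue bound for \<open>A\<close>. Where \<open>r u = 0\<close>, the row of \<open>C\<close>
  vanishes, and division by zero gives a zero row of \<open>A\<close> as required.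
\<close>

lemma psd_total_le_trace:
  assumes fin: "finite V" "V \<noteq> {}" and C: "psd V C"
    and E: "\<And>u v. u \<in> V \<Longrightarrow> v \<in> V \<Longrightarrow> u \<noteq> v \<Longrightarrow> C u v \<noteq> 0 \<Longrightarrow> (u, v) \<in> E"
    and no_walk: "\<And>u j. odd j \<Longrightarrow> j \<le> d \<Longrightarrow> (u, u) \<notin> E ^^ j"
    and "odd d" "0 \<le> t" "real (card V) - 1 \<le> cosh (real d * t)"
  shows "(\<Sum>u\<in>V. \<Sum>v\<in>V. C u v) \<le> (1 + cosh t) * (\<Sum>u\<in>V. C u u)"
proof -
  define r where "r u = sqrt (C u u)" for u
  define A where "A u v = (if u = v then 0 else C u v / (r u * r v))" for u v
  have sym: "sym_mat V C"
    using C by (simp add: psd_def)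
  have r2: "(r u)\<^sup>2 = C u u" if "u \<in> V" for u
    using psd_diag_nonneg[OF fin(1) C that] by (simp add: r_def)
  have zero: "C u v = 0" if "u \<in> V" "v \<in> V" "r u = 0 \<or> r v = 0" for u v
    using psd_zero_row[OF fin(1) C that(1,2)] psd_zero_row[OF fin(1) C that(2,1)] that sym
    by (auto simp: r_def sym_mat_def)
  have split: "(\<Sum>u\<in>V. \<Sum>v\<in>V. (if v = u then (y u)\<^sup>2 else 0) + A u v * (y u * y v))
      = sum_sq V y + quad V A y" for y
    using fin(1) by (simp add: sum.distrib sum_sq_def pairing_def)
  have A: "quad V A y \<le> cosh t * sum_sq V y" for y
  proof (rule quad_le_cosh[OF fin _ _ no_walk])
    show "sym_mat V A"
      using sym by (simp add: sym_mat_def A_def mult.commute)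
    show "(u, v) \<in> E" if "u \<in> V" "v \<in> V" "A u v \<noteq> 0" for u v
      using E that by (auto simp: A_def split: if_splits)
    fix y
    have "0 \<le> quad V C (\<lambda>u. y u / r u)"
      by (rule psdD[OF C])
    also have "\<dots> \<le> (\<Sum>u\<in>V. \<Sum>v\<in>V. (if v = u then (y u)\<^sup>2 else 0) + A u v * (y u * y v))"
      unfolding pairing_def
    proof (intro sum_mono)
      fix u v assume uv: "u \<in> V" "v \<in> V"
      show "C u v * (y u / r u * (y v / r v))
          \<le> (if v = u then (y u)\<^sup>2 else 0) + A u v * (y u * y v)"
      proof (cases "v = u")
        case True
        have "C u u * (y u / r u * (y u / r u)) \<le> (y u)\<^sup>2"
          using r2[OF uv(1)] by (cases "r u = 0") (auto simp: power2_eq_square field_simps)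
        then show ?thesis
          using True by (simp add: A_def)
      qed (simp add: A_def)
    qed
    finally show "0 \<le> sum_sq V y + quad V A y"
      unfolding split .
  qed (use assms in auto)
  have "(\<Sum>u\<in>V. \<Sum>v\<in>V. C u v)
      = (\<Sum>u\<in>V. \<Sum>v\<in>V. (if v = u then (r u)\<^sup>2 else 0) + A u v * (r u * r v))"
    using zero r2 by (intro sum.cong refl) (auto simp: A_def)
  also have "\<dots> = sum_sq V r + quad V A r"
    by (rule split)
  also have "\<dots> \<le> (1 + cosh t) * sum_sq V r"
    using A[of r] by (simp add: algebra_simps)
  also have "sum_sq V r = (\<Sum>u\<in>V. C u u)"
    unfolding sum_sq_def using r2 by (intro sum.cong) auto
  finally show ?thesis .
qed

text \<open>
  In the notation of the introduction, \<open>P = Z - J\<close>: the matrix \<open>J + P\<close> has diagonal \<open>1 + cosh t\<close> and is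
  zero on \<open>E\<close>. The pairing of a dual witness \<open>C\<close> with the prescribed values is \<open>1 + cosh t\<close> times the
  trace of \<open>C\<close> minus the sum of its entries, which the preceding lemma shows to be nonnegative.
\<close>

lemma large_odd_girth_certificate:
  assumes fin: "finite V" "V \<noteq> {}" and E: "E \<subseteq> V \<times> V" "sym E"
    and no_walk: "\<And>u j. odd j \<Longrightarrow> j \<le> d \<Longrightarrow> (u, u) \<notin> E ^^ j"
    and d: "odd d" and t: "0 \<le> t" "real (card V) - 1 \<le> cosh (real d * t)"
  obtains P where "dual_psd V P" "\<And>u. u \<in> V \<Longrightarrow> P u u = cosh t"
    "\<And>u v. (u, v) \<in> E \<Longrightarrow> P u v = - 1"
proof -
  define b where "b u v = (if u = v then cosh t else - 1)" for u v :: 'a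
  have irrefl: "u \<noteq> v" if "(u, v) \<in> E" for u v
    using no_walk[of 1 u] odd_pos[OF d] that by (auto simp: Suc_le_eq)
  show thesis
  proof (rule conic_alternative[OF fin(1), of "Id_on V \<union> E" b])
    show "Id_on V \<union> E \<subseteq> V \<times> V" "\<And>v. v \<in> V \<Longrightarrow> (v, v) \<in> Id_on V \<union> E" "sym (Id_on V \<union> E)"
      "\<And>u v. b u v = b v u"
      using E by (auto simp: b_def sym_def)
  next
    fix P assume P: "dual_psd V P" "\<And>u v. (u, v) \<in> Id_on V \<union> E \<Longrightarrow> P u v = b u v"
    show thesis
    proof (rule that[OF P(1)])
      show "P u u = cosh t" if "u \<in> V" for u
        using P(2)[of u u] that by (auto simp: b_def)
      show "P u v = - 1" if "(u, v) \<in> E" for u v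
        using P(2)[of u v] that irrefl by (auto simp: b_def)
    qed
  next
    fix C assume C: "psd V C" "\<And>u v. (u, v) \<notin> Id_on V \<union> E \<Longrightarrow> C u v = 0" "pairing V C b < 0"
    have "pairing V C b = (\<Sum>u\<in>V. \<Sum>v\<in>V. (if v = u then (1 + cosh t) * C u u else 0) - C u v)"
      unfolding pairing_def by (intro sum.cong) (auto simp: b_def algebra_simps)
    also have "\<dots> = (1 + cosh t) * (\<Sum>u\<in>V. C u u) - (\<Sum>u\<in>V. \<Sum>v\<in>V. C u v)"
      using fin(1) by (simp add: sum_subtractf sum_distrib_left)
    also have "\<dots> \<ge> 0"
    proof -
      have "(u, v) \<in> E" if "u \<noteq> v" "C u v \<noteq> 0" for u v
        using C(2)[of u v] that by auto
      then show ?thesis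
        using psd_total_le_trace[OF fin C(1) _ no_walk d t] by simp
    qed
    finally show thesis
      using C(3) by simp
  qed
qed

text \<open>
  The induction step is \<open>(1 + R) (1 + P) - 1 = R P + R + P\<close>.
\<close>

lemma dual_psd_prod_minus_one:
  fixes k :: nat
  assumes "\<And>i. i < k \<Longrightarrow> dual_psd V (P i)"
  shows "dual_psd V (\<lambda>u v. (\<Prod>i<k. 1 + P i u v) - 1)"
  using assms
proof (induction k)
  case 0
  show ?case
    using dual_psd_scale[OF order_refl dual_psd_rank_one] by simp
next
  case (Suc k)
  let ?R = "\<lambda>u v. (\<Prod>i<k. 1 + P i u v) - 1"
  have "dual_psd V (\<lambda>u v. ?R u v * P k u v + (?R u v + P k u v))"
    using Suc by (intro dual_psd_add dual_psd_hadamard) auto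
  moreover have "?R u v * P k u v + (?R u v + P k u v) = (\<Prod>i<Suc k. 1 + P i u v) - 1" for u v
    by (simp add: algebra_simps)
  ultimately show ?case
    by simp
qed

text \<open>
  The entrywise product of the matrices \<open>1 + P i\<close> is zero off the diagonal, so its quadratic form at the
  all-ones vector is \<open>n (1 + s) ^ k\<close>, while that of the all-ones matrix is \<open>n\<^sup>2\<close>.
\<close>

lemma card_le_power_of_cover:
  fixes k :: nat
  assumes fin: "finite V" "V \<noteq> {}"
    and P: "\<And>i. i < k \<Longrightarrow> dual_psd V (P i)" "\<And>i u. i < k \<Longrightarrow> u \<in> V \<Longrightarrow> P i u u = s"
    and cover: "\<And>u v. u \<in> V \<Longrightarrow> v \<in> V \<Longrightarrow> u \<noteq> v \<Longrightarrow> \<exists>i<k. P i u v = - 1"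
  shows "real (card V) \<le> (1 + s) ^ k"
proof -
  have "0 \<le> quad V (\<lambda>u v. (\<Prod>i<k. 1 + P i u v) - 1) (\<lambda>_. 1)"
    by (intro psdD dual_psd_imp_psd dual_psd_prod_minus_one P)
  also have "\<dots> = (\<Sum>u\<in>V. \<Sum>v\<in>V. (if v = u then (1 + s) ^ k else 0) - 1)"
    unfolding pairing_def
  proof (intro sum.cong refl)
    fix u v assume uv: "u \<in> V" "v \<in> V"
    show "((\<Prod>i<k. 1 + P i u v) - 1) * (1 * 1) = (if v = u then (1 + s) ^ k else 0) - 1"
    proof (cases "v = u")
      case True
      then show ?thesis
        using P(2) uv by simp
    next
      case False
      then have "(\<Prod>i<k. 1 + P i u v) = 0"
        using cover[OF uv] by (intro prod_zero) (auto intro!: bexI)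
      then show ?thesis
        using False by simp
    qed
  qed
  also have "\<dots> = real (card V) * ((1 + s) ^ k - real (card V))"
    using fin(1) by (simp add: sum_subtractf algebra_simps)
  finally show ?thesis
    using fin by (simp add: zero_le_mult_iff card_gt_0_iff)
qed

section \<open>Closed odd walks and odd cycles\<close>

text \<open>
  A closed walk that repeats a vertex splits there into two shorter closed walks, one of which is odd.
\<close>

lemma (in wf_digraph) odd_closed_walk_imp_odd_cycle:
  assumes "awalk u p u" "odd (length p)"
  shows "\<exists>q. cycle q \<and> odd (length q) \<and> length q \<le> length p \<and> set q \<subseteq> set p"
  using assms
proof (induction "length p" arbitrary: u p rule: less_induct)
  case less
  show ?case
  proof (cases "distinct (tl (awalk_verts u p))")
    case True
    then have "cycle p"
      using less.prems unfolding cycle_def by (intro exI[of _ u]) auto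
    then show ?thesis
      using less.prems by blast
  next
    case False
    then obtain e es where p: "p = e # es"
      by (cases p) auto
    with less.prems False have es: "awalk (head G e) es u" "\<not> distinct (awalk_verts (head G e) es)"
      and e: "awalk u [e] (head G e)"
      by (auto simp: awalk_simps)
    then obtain q r s w where qrs: "es = q @ r @ s" "0 < length r"
      and w: "awalk (head G e) q w" "awalk w r w" "awalk w s u"
      using awalk_not_distinct_decomp[OF es] by blast
    show ?thesis
    proof (cases "odd (length r)")
      case True
      then show ?thesis
        using less.hyps[of r w] w(2) by (fastforce simp: p qrs)
    next
      case False
      have "awalk u ([e] @ q @ s) u"
        by (intro awalk_appendI[OF e] awalk_appendI[OF w(1,3)])
      moreover have "odd (length ([e] @ q @ s))"
        using False less.prems(2) by (simp add: p qrs)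
      ultimately show ?thesis
        using less.hyps[of "[e] @ q @ s" u] qrs(2) by (fastforce simp: p qrs)
    qed
  qed
qed

lemma (in wf_digraph) relpow_imp_awalk:
  assumes R: "\<And>a b. (a, b) \<in> R \<Longrightarrow> \<exists>e\<in>arcs G. tail G e = a \<and> head G e = b \<and> Q e"
    and "u \<in> verts G" "(u, v) \<in> R ^^ j"
  shows "\<exists>p. awalk u p v \<and> length p = j \<and> (\<forall>e\<in>set p. Q e)"
  using assms(2-)
proof (induction j arbitrary: u)
  case 0
  then show ?case
    by (auto simp: awalk_simps)
next
  case (Suc j)
  obtain w where w: "(u, w) \<in> R" "(w, v) \<in> R ^^ j"
    using Suc.prems(2) by (meson relpow_Suc_E2)
  obtain e where e: "e \<in> arcs G" "tail G e = u" "head G e = w" "Q e"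
    using R[OF w(1)] by blast
  then obtain p where p: "awalk w p v" "length p = j" "\<forall>e\<in>set p. Q e"
    using Suc.IH[OF _ w(2)] by auto
  then show ?case
    using e by (intro exI[of _ "e # p"]) (auto simp: awalk_simps)
qed

text \<open>
  The absence of loops excludes odd cycles of length 1.
\<close>

lemma complete_digraph_odd_closed_walk:
  assumes K: "K\<^bsub>n\<^esub> G"
    and walk: "(u, u) \<in> {(u, v). u \<in> verts G \<and> v \<in> verts G \<and> u \<noteq> v \<and> c {u, v} = i} ^^ j"
    and "odd j"
  shows "\<exists>p. odd_cycle G p \<and> monochromatic G c p \<and> length p \<le> j"
proof -
  interpret graph G
    using K by (simp add: complete_digraph_def)
  let ?R = "{(u, v). u \<in> verts G \<and> v \<in> verts G \<and> u \<noteq> v \<and> c {u, v} = i}"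
  have arc: "\<exists>e\<in>arcs G. tail G e = a \<and> head G e = b \<and> c (arc_edge G e) = i" if "(a, b) \<in> ?R" for a b
  proof -
    have "(a, b) \<in> arcs_ends G"
      using K that by (auto simp: complete_digraph_def)
    then show ?thesis
      using that by (auto simp: arcs_ends_def arc_to_ends_def arc_edge_def)
  qed
  have "j \<noteq> 0"
    using odd_pos[OF \<open>odd j\<close>] by simp
  then have "u \<in> verts G"
    using walk by (cases j) (auto elim!: relpow_Suc_E2)
  then obtain p where p: "awalk u p u" "length p = j" "\<forall>e\<in>set p. c (arc_edge G e) = i"
    using relpow_imp_awalk[OF arc _ walk] by auto
  then obtain q where q: "cycle q" "odd (length q)" "length q \<le> j" "set q \<subseteq> set p"
    using odd_closed_walk_imp_odd_cycle[of u p] \<open>odd j\<close> by auto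
  have "2 \<le> length q"
    using q(1) cycle_digraph_conv by blast
  then have "3 \<le> length q"
    using q(2) by (cases "length q = 2") auto
  then have "odd_cycle G q" "monochromatic G c q"
    using q p(3) by (auto simp: odd_cycle_def monochromatic_def)
  then show ?thesis
    using q(3) by blast
qed

section \<open>Numerical estimates\<close>

lemma cosh_less_one_plus_square:
  fixes t :: real
  assumes "0 < t" "t \<le> 1"
  shows "cosh t < 1 + t\<^sup>2"
proof -
  \<comment> \<open>\<open>exp (- t)\<close> is estimated from above through the lower Taylor bound for its reciprocal\<close>
  have "1 \<le> 1 + (t\<^sup>2)\<^sup>2 / 4"
    by simp
  also have "\<dots> = (1 + t + t\<^sup>2 / 2) * (1 - t + t\<^sup>2 / 2)"
    by (simp add: power2_eq_square algebra_simps)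
  also have "\<dots> \<le> exp t * (1 - t + t\<^sup>2 / 2)"
    using assms exp_lower_Taylor_quadratic[of t] by (intro mult_right_mono) auto
  finally have "exp (- t) \<le> 1 - t + t\<^sup>2 / 2"
    by (simp add: exp_minus field_simps)
  moreover have "exp t \<le> 1 + t + t\<^sup>2"
    using exp_bound[of t] assms by simp
  ultimately have "exp t + exp (- t) \<le> (1 + t + t\<^sup>2) + (1 - t + t\<^sup>2 / 2)"
    by (intro add_mono)
  also have "\<dots> < 2 * (1 + t\<^sup>2)"
    using assms by simp
  finally show ?thesis
    by (simp add: cosh_field_def)
qed

text \<open>
  The estimate is tight enough to need the \<open>-1\<close>: for \<open>k = 1\<close> it says \<open>3 \<le> cosh 2\<close>, proved from \<open>exp 2 \<ge> 6\<close>.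
\<close>

lemma power_of_two_le_cosh:
  assumes "1 \<le> k"
  shows "2 ^ (k + 1) - 1 \<le> cosh (4 * real k - 2)"
proof -
  obtain m where k: "k = Suc m"
    using assms by (cases k) auto
  have e2: "6 \<le> exp (2 :: real)"
  proof -
    have "(5 / 2) ^ 2 \<le> exp (1 :: real) ^ 2"
      using exp_lower_Taylor_quadratic[of "1 :: real"] by (intro power_mono) auto
    then show ?thesis
      by (simp add: power2_eq_square flip: exp_add)
  qed
  have "(16 :: real) \<le> exp 4"
  proof -
    have "6 * 6 \<le> exp (2 :: real) * exp 2"
      using e2 by (intro mult_mono) auto
    then show ?thesis
      by (simp flip: exp_add)
  qed
  then have "6 * 16 ^ m \<le> exp 2 * exp (4 :: real) ^ m"
    using e2 by (intro mult_mono power_mono) auto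
  also have "\<dots> = exp (4 * real k - 2)"
    by (simp add: k algebra_simps flip: exp_of_nat_mult exp_add)
  finally have exp: "6 * 16 ^ m \<le> exp (4 * real k - 2)" .
  define x where "x = (2 :: real) ^ m"
  have x: "1 \<le> x"
    by (simp add: x_def)
  have "16 ^ m = x ^ 4"
  proof -
    have "x ^ 4 = (2 ^ 4) ^ m"
      unfolding x_def by (simp only: mult.commute flip: power_mult)
    then show ?thesis
      by simp
  qed
  moreover have "x ^ 2 \<le> x ^ 4"
    using x by (intro power_increasing) auto
  moreover have "0 \<le> (6 * x - 2) * (x - 1)"
    using x by simp
  ultimately have "8 * x - 2 \<le> 6 * 16 ^ m"
    by (simp add: algebra_simps power2_eq_square)
  with exp have "8 * x - 2 \<le> exp (4 * real k - 2)"
    by linarith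
  moreover have "0 < exp (- (4 * real k - 2))"
    by simp
  ultimately have "(8 * x - 2) / 2 \<le> cosh (4 * real k - 2)"
    unfolding cosh_field_def by (intro divide_right_mono) linarith+
  then show ?thesis
    by (simp add: x_def k)
qed

lemma power_less_one_plus:
  fixes \<delta> :: real
  assumes "0 < \<delta>" "\<delta> \<le> 1" "1 \<le> k"
  shows "(1 + \<delta> / (2 * real k)) ^ k < 1 + \<delta>"
proof -
  have "(1 + \<delta> / (2 * real k)) ^ k \<le> exp (\<delta> / (2 * real k)) ^ k"
    using assms by (intro power_mono exp_ge_add_one_self) auto
  also have "\<dots> = exp (\<delta> / 2)"
    using assms by (simp flip: exp_of_nat_mult)
  also have "\<dots> \<le> 1 + \<delta> / 2 + (\<delta> / 2)\<^sup>2"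
    using assms by (intro exp_bound) auto
  also have "\<dots> < 1 + \<delta>"
  proof -
    have "\<delta> * \<delta> \<le> 1 * \<delta>"
      using assms by (intro mult_right_mono) auto
    then show ?thesis
      using assms unfolding power2_eq_square by (simp add: field_simps)
  qed
  finally show ?thesis .
qed

lemma ex_odd_near:
  fixes L :: real
  assumes "1 \<le> L"
  obtains d :: nat where "odd d" "real d \<le> L" "L - 2 \<le> real d"
proof
  let ?m = "nat \<lfloor>(L - 1) / 2\<rfloor>"
  have "real ?m = of_int \<lfloor>(L - 1) / 2\<rfloor>"
    using assms by simp
  with floor_correct[of "(L - 1) / 2"] show "real (2 * ?m + 1) \<le> L" "L - 2 \<le> real (2 * ?m + 1)"
    by (simp_all add: field_simps)
qed simp

section \<open>Monochromatic odd cycles in complete graphs\<close>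

text \<open>
  \<open>t\<close> is chosen so that \<open>(1 + cosh t) ^ k\<close> stays below \<open>n\<close>. Rounding the length bound \<open>L\<close> down to an odd
  number \<open>d\<close> loses at most 2, so \<open>d * t \<ge> 4 * k - 2\<close>.
\<close>

theorem theorem1p5:
  fixes k n :: nat and \<delta> :: real
    and G :: "('a, 'b) pre_digraph" and c :: "'a set \<Rightarrow> nat"
  assumes "k \<ge> 1" and "0 < \<delta>" and "\<delta> \<le> 1"
    and "real n = (1 + \<delta>) * 2 ^ k"
    and "K\<^bsub>n\<^esub> G"
    and "edge_colouring G k c"
  shows "\<exists>p. odd_cycle G p \<and> monochromatic G c p \<and>
           real (length p) \<le> 4 * real k powr (3/2) * \<delta> powr (- 1/2)"
proof (rule ccontr)
  assume no_cycle: "\<not> ?thesis"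
  define V where "V = verts G"
  define E where "E i = {(u, v). u \<in> V \<and> v \<in> V \<and> u \<noteq> v \<and> c {u, v} = i}" for i
  define t where "t = sqrt (\<delta> / real k)"
  define L where "L = 4 * real k powr (3/2) * \<delta> powr (- 1/2)"
  have t: "0 < t" "t \<le> 1" "t\<^sup>2 = \<delta> / real k"
    using assms(1-3) by (auto simp: t_def)
  have Lt: "L * t = 4 * real k"
  proof -
    have "real k powr (3/2) = real k * sqrt (real k)"
      using assms(1) powr_add[of "real k" 1 "1/2"] by (simp add: powr_half_sqrt)
    moreover have "\<delta> powr (- 1/2) = 1 / sqrt \<delta>"
      using assms(2) powr_minus_divide[of \<delta> "1/2"] by (simp add: powr_half_sqrt)
    ultimately show ?thesis
      using assms(1,2) by (simp add: L_def t_def real_sqrt_divide)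
  qed
  have "1 \<le> L"
  proof -
    have "4 * real k \<le> L * 1"
      unfolding Lt[symmetric] using t by (intro mult_left_mono) (auto simp: L_def)
    then show ?thesis
      using assms(1) by simp
  qed
  then obtain d where d: "odd d" "real d \<le> L" "L - 2 \<le> real d"
    by (rule ex_odd_near)
  have fin: "finite V" and card: "card V = n"
    using assms(5) unfolding V_def complete_digraph_def
    by (auto dest: graph.axioms digraph.axioms fin_digraph.finite_verts)
  have "0 < real n"
    unfolding assms(4) using assms(2) by simp
  with card have ne: "V \<noteq> {}"
    by auto
  have dt: "real (card V) - 1 \<le> cosh (real d * t)"
  proof -
    have "real (card V) - 1 \<le> 2 ^ (k + 1) - 1"
      unfolding card assms(4) using assms(3) by simp
    also have "\<dots> \<le> cosh (4 * real k - 2)"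
      using assms(1) by (rule power_of_two_le_cosh)
    also have "\<dots> \<le> cosh (real d * t)"
    proof -
      have "4 * real k - 2 \<le> (L - 2) * t"
        using t by (simp add: left_diff_distrib Lt)
      also have "\<dots> \<le> real d * t"
        using d(3) t by (intro mult_right_mono) auto
      finally have "4 * real k - 2 \<le> real d * t" .
      then show ?thesis
        using assms(1) t by (subst cosh_real_nonneg_le_iff) auto
    qed
    finally show ?thesis .
  qed
  have no_walk: "(u, u) \<notin> E i ^^ j" if j: "odd j" "j \<le> d" for u i j
  proof
    assume "(u, u) \<in> E i ^^ j"
    then obtain p where "odd_cycle G p" "monochromatic G c p" "length p \<le> j"
      using complete_digraph_odd_closed_walk[OF assms(5) _ j(1)] unfolding E_def V_def by blast
    moreover have "real (length p) \<le> L"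
      using \<open>length p \<le> j\<close> j(2) d(2) by linarith
    ultimately show False
      using no_cycle unfolding L_def by blast
  qed
  have "\<exists>P. dual_psd V P \<and> (\<forall>u\<in>V. P u u = cosh t) \<and> (\<forall>(u, v)\<in>E i. P u v = - 1)" for i
  proof (rule large_odd_girth_certificate[OF fin ne _ _ no_walk d(1) less_imp_le[OF t(1)] dt])
    show "E i \<subseteq> V \<times> V" "sym (E i)"
      by (auto simp: E_def sym_def insert_commute)
  qed auto
  then have "\<exists>P. \<forall>i. dual_psd V (P i) \<and> (\<forall>u\<in>V. P i u u = cosh t) \<and> (\<forall>(u, v)\<in>E i. P i u v = - 1)"
    by (intro choice allI)
  then obtain P where cert: "\<forall>i. dual_psd V (P i) \<and> (\<forall>u\<in>V. P i u u = cosh t)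
      \<and> (\<forall>(u, v)\<in>E i. P i u v = - 1)"
    by (rule exE)
  then have P: "\<And>i. dual_psd V (P i)" "\<And>i u. u \<in> V \<Longrightarrow> P i u u = cosh t"
    "\<And>i u v. (u, v) \<in> E i \<Longrightarrow> P i u v = - 1"
    by auto
  have "real (card V) \<le> (1 + cosh t) ^ k"
  proof (rule card_le_power_of_cover[OF fin ne])
    fix u v assume uv: "u \<in> V" "v \<in> V" "u \<noteq> v"
    then have "{u, v} \<in> edge_set G"
      using edge_set_complete[OF assms(5)] by (auto simp: V_def)
    then have "c {u, v} < k"
      using assms(6) by (auto simp: edge_colouring_def)
    moreover have "(u, v) \<in> E (c {u, v})"
      using uv by (simp add: E_def)
    ultimately show "\<exists>i<k. P i u v = - 1"
      using P(3) by blast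
  qed (use P in auto)
  also have "\<dots> < (2 * (1 + \<delta> / (2 * real k))) ^ k"
    using assms(1) cosh_less_one_plus_square[OF t(1,2)] cosh_real_ge_1[of t]
    by (intro power_strict_mono) (auto simp: t(3))
  also have "\<dots> = 2 ^ k * (1 + \<delta> / (2 * real k)) ^ k"
    by (rule power_mult_distrib)
  also have "\<dots> < 2 ^ k * (1 + \<delta>)"
    using power_less_one_plus[OF assms(2,3,1)] by simp
  finally show False
    by (simp add: card assms(4) mult.commute)
qed

end
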